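(* Let $\mathbb{K}=\mathbb{R}$ or $\mathbb{C}$ and $1\le m\le n$. Suppose that for some $X\subset Mat_{m\times n}(\mathbb{K})$ the set $\overline{X_r}$ consists of linear subspaces, i.e. is a union of linear subspaces (they all intersect, as the zero matrix belongs to each of them). Then $\overline{X_r}$ is Lipschitz normally embedded. For example, let $X$ be the subspace of upper triangular matrices (or the subspace of lower triangular matrices) in $Mat_{m\times m}(\mathbb{R})$; then $\overline{X_{m-1}}$ is Lipschitz normally embedded. As all the linear subspaces $L_i$ of which $\overline{X_{m-1}}$ consists are orthogonal in this case, the optimal Lipschitz constant is $\sqrt{2}$, i.e. $\sqrt{2}$ is the smallest $K$ such that $d_{in}^{\overline{X_{m-1}}}(A,B)\le K\,d_{out}(A,B)$ for all $A,B\in\overline{X_{m-1}}$.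
   Context: $Mat_{m\times n}(\mathbb{K})\cong\mathbb{K}^{mn}$ is the space of $m\times n$ matrices with the Euclidean metric coming from $\langle A,B\rangle=\operatorname{trace}(A\overline{B^t})$. For $X\subseteq Mat_{m\times n}(\mathbb{K})$, $X_r=\{A\in X:\operatorname{rank}(A)=r\}$ and $\overline{X_r}$ is its closure. For a subset $Y$ of a Euclidean space, $d_{out}(x,y)=\|x-y\|$ and $d_{in}^{Y}(x,y)$ is the infimum of Euclidean lengths of rectifiable paths in $Y$ joining $x$ to $y$. $Y$ is Lipschitz normally embedded if there exists $K\ge 1$ such that $d_{in}^{Y}(x,y)\le K\,d_{out}(x,y)$ for all $x,y\in Y$. Two linear subspaces $L_i,L_j$, neither contained in the other, are called orthogonal here if the angle between them is $\pi/2$, where the angle is the minimal angle between non-zero vectors of $L_i\cap\mathcal{N}$ and of $L_j\cap\mathcal{N}$, with $\mathcal{N}$ the orthogonal complement of $L_i\cap L_j$.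
   Formalization: The union of linear subspaces is taken to be finite (the claim fails for infinitely many lines in the plane with converging directions), and optimality of √2 is stated only for m ≥ 2 (for m = 1 the closure is {0}). *)

theory Defs
  imports "HOL-Analysis.Analysis"
begin

section \<open>Matrices over the reals and the complex numbers\<close>

text \<open>An \<open>m \<times> n\<close> matrix has type \<open>'a^'n^'m\<close> (\<open>'m\<close> indexes the rows). The library metric on this
  type is the Euclidean one, as the following two facts confirm; over the complex numbers the
  library inner product is the real part of the Hermitian one, with the same norm.\<close>

lemma inner_matrix_real:
  fixes A B :: "real^'n^'m"
  shows "inner A B = trace (A ** transpose B)"
  by (simp add: inner_vec_def trace_def matrix_matrix_mult_def transpose_def)

lemma inner_matrix_complex:
  fixes A B :: "complex^'n^'m"
  shows "inner A B = Re (trace (A ** transpose (\<chi> i j. cnj (B $ i $ j))))"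
  by (simp add: inner_vec_def trace_def matrix_matrix_mult_def transpose_def inner_complex_def)

definition rank_stratum :: "('a::field^'n^'m) set \<Rightarrow> nat \<Rightarrow> ('a^'n^'m) set" where
  "rank_stratum X r = {A \<in> X. rank A = r}"

text \<open>Linear subspaces over the field of the matrix entries; so over the complex numbers these are
  the complex subspaces.\<close>

definition matrix_subspace :: "('a::field^'n^'m) set \<Rightarrow> bool" where
  "matrix_subspace = module.subspace (\<lambda>c A. \<chi> i. c *s A $ i)"

lemma matrix_subspace_iff:
  fixes L :: "('a::field^'n^'m) set"
  shows "matrix_subspace L \<longleftrightarrow>
    0 \<in> L \<and> (\<forall>A\<in>L. \<forall>B\<in>L. A + B \<in> L) \<and> (\<forall>c. \<forall>A\<in>L. (\<chi> i. c *s A $ i) \<in> L)"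
proof -
  have "module (\<lambda>c (A :: 'a^'n^'m). \<chi> i. c *s A $ i)"
    by unfold_locales (simp_all add: vec_eq_iff algebra_simps)
  then show ?thesis
    unfolding matrix_subspace_def by (simp add: module.subspace_def)
qed

lemma matrix_subspace_real: "matrix_subspace L \<longleftrightarrow> subspace L" for L :: "(real^'n^'m) set"
proof -
  have "(\<chi> i. c *s A $ i) = c *\<^sub>R A" for c and A :: "real^'n^'m"
    by (simp add: vec_eq_iff)
  then show ?thesis
    by (simp add: matrix_subspace_iff subspace_def)
qed

text \<open>Finiteness is essential: lines through the origin of the plane whose directions converge form
  a closed union of linear subspaces that is not Lipschitz normally embedded.\<close>

definition union_of_subspaces :: "('a::field^'n^'m) set set \<Rightarrow> ('a^'n^'m) set \<Rightarrow> bool" where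
  "union_of_subspaces \<L> Y \<longleftrightarrow> finite \<L> \<and> (\<forall>L\<in>\<L>. matrix_subspace L) \<and> Y = \<Union>\<L>"

definition irredundant :: "'a set set \<Rightarrow> bool" where
  "irredundant \<L> \<longleftrightarrow> (\<forall>L\<in>\<L>. \<forall>M\<in>\<L>. L \<subseteq> M \<longrightarrow> L = M)"

definition upper_triangular_matrices :: "(real^'k::{finite,linorder}^'k::{finite,linorder}) set" where
  "upper_triangular_matrices = {A. \<forall>i j. j < i \<longrightarrow> A $ i $ j = 0}"

definition lower_triangular_matrices :: "(real^'k::{finite,linorder}^'k::{finite,linorder}) set" where
  "lower_triangular_matrices = {A. \<forall>i j. i < j \<longrightarrow> A $ i $ j = 0}"


section \<open>Inner distance and Lipschitz normal embedding\<close>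

text \<open>The supremum over all partitions of the unit interval, possibly infinite. Degenerate
  partitions (repeated points, or not reaching the ends) do not change the supremum.\<close>

definition path_length :: "(real \<Rightarrow> 'a::metric_space) \<Rightarrow> ereal" where
  "path_length g =
    (SUP (t, n) \<in> {(t :: nat \<Rightarrow> real, n :: nat). mono t \<and> range t \<subseteq> {0..1}}.
       ereal (\<Sum>i<n. dist (g (t i)) (g (t (Suc i)))))"

definition rectifiable_path :: "(real \<Rightarrow> 'a::metric_space) \<Rightarrow> bool" where
  "rectifiable_path g \<longleftrightarrow> path g \<and> path_length g < \<infinity>"

text \<open>The value is \<open>\<infinity>\<close> if no rectifiable path in \<open>Y\<close> joins the two points.\<close>

definition inner_dist :: "'a::metric_space set \<Rightarrow> 'a \<Rightarrow> 'a \<Rightarrow> ereal" where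
  "inner_dist Y x y =
    (INF g \<in> {g. rectifiable_path g \<and> path_image g \<subseteq> Y \<and> pathstart g = x \<and> pathfinish g = y}.
       path_length g)"

definition inner_dist_bound :: "'a::metric_space set \<Rightarrow> real \<Rightarrow> bool" where
  "inner_dist_bound Y K \<longleftrightarrow> (\<forall>x\<in>Y. \<forall>y\<in>Y. inner_dist Y x y \<le> ereal (K * dist x y))"

definition lipschitz_normally_embedded :: "'a::metric_space set \<Rightarrow> bool" where
  "lipschitz_normally_embedded Y \<longleftrightarrow> (\<exists>K\<ge>1. inner_dist_bound Y K)"


section \<open>Angles between linear subspaces\<close>

text \<open>Meaningful for subspaces neither of which contains the other, as then both intersections
  below contain non-zero vectors. By compactness the infimum is a minimum.\<close>

definition subspace_angle :: "'a::euclidean_space set \<Rightarrow> 'a set \<Rightarrow> real" where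
  "subspace_angle L M =
    (INF (u, v) \<in> (L \<inter> (L \<inter> M)\<^sup>\<bottom> - {0}) \<times> (M \<inter> (L \<inter> M)\<^sup>\<bottom> - {0}).
       arccos (inner u v / (norm u * norm v)))"

definition orthogonal_subspaces :: "'a::euclidean_space set \<Rightarrow> 'a set \<Rightarrow> bool" where
  "orthogonal_subspaces L M \<longleftrightarrow> \<not> L \<subseteq> M \<and> \<not> M \<subseteq> L \<and> subspace_angle L M = pi / 2"

end

(* Inside one subspace the two distances agree; between two subspaces L and M one travels through
   L \<inter> M, and the detour is controlled by the angle between the parts of L and M orthogonal to
   L \<inter> M. For triangular matrices the closure is the union of the hyperplanes (of the space of
   triangular matrices) on which one given diagonal entry vanishes: the angles are right angles,
   so the detour costs the ratio of two legs to the hypotenuse, at most sqrt 2. *)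

theory Submission
  imports Defs
begin

section \<open>Path length and a two-segment bound for the inner distance\<close>

lemma path_length_le_of_modulus:
  fixes g :: "real \<Rightarrow> 'a::metric_space" and \<phi> :: "real \<Rightarrow> real"
  assumes "\<And>s t. 0 \<le> s \<Longrightarrow> s \<le> t \<Longrightarrow> t \<le> 1 \<Longrightarrow> dist (g s) (g t) \<le> \<phi> t - \<phi> s"
  shows "path_length g \<le> ereal (\<phi> 1 - \<phi> 0)"
  unfolding path_length_def
proof (rule SUP_least, clarsimp)
  fix t :: "nat \<Rightarrow> real" and n
  assume "mono t" and range: "range t \<subseteq> {0..1}"
  have t01: "0 \<le> t i" "t i \<le> 1" for i
    using range by (meson atLeastAtMost_iff range_subsetD)+
  have mono_\<phi>: "\<phi> s \<le> \<phi> u" if "0 \<le> s" "s \<le> u" "u \<le> 1" for s u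
    using assms[OF that] zero_le_dist[of "g s" "g u"] by linarith
  have "(\<Sum>i<n. dist (g (t i)) (g (t (Suc i)))) \<le> (\<Sum>i<n. \<phi> (t (Suc i)) - \<phi> (t i))"
    by (intro sum_mono assms) (auto simp: t01 monoD[OF \<open>mono t\<close>])
  also have "\<dots> = \<phi> (t n) - \<phi> (t 0)"
    by (rule sum_lessThan_telescope)
  \<comment> \<open>A partition may start after 0 or stop before 1; monotonicity of
    \<open>\<phi>\<close> makes up for the missing ends.\<close>
  also have "\<dots> \<le> \<phi> 1 - \<phi> 0"
    using mono_\<phi>[of "t n" 1] mono_\<phi>[of 0 "t 0"] t01 by (simp add: diff_mono)
  finally show "(\<Sum>i<n. dist (g (t i)) (g (t (Suc i)))) \<le> \<phi> 1 - \<phi> 0" .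
qed

lemma dist_linepath:
  "dist (linepath a b s) (linepath a b t) = \<bar>t - s\<bar> * dist a b"
proof -
  have "linepath a b s - linepath a b t = (t - s) *\<^sub>R (a - b)"
    by (simp add: linepath_def algebra_simps)
  then show ?thesis
    by (simp add: dist_norm)
qed

lemma path_length_two_segments_le:
  fixes x y z :: "'a::real_normed_vector"
  shows "path_length (linepath x z +++ linepath z y) \<le> ereal (dist x z + dist z y)"
proof -
  \<comment> \<open>\<open>\<phi> t\<close> is the length travelled up to time \<open>t\<close>;
    each segment takes half the time, hence the doubled speed.\<close>
  define \<phi> where "\<phi> t = (if t \<le> 1/2 then 2 * t * dist x z else dist x z + (2 * t - 1) * dist z y)"
    for t :: real
  let ?g = "linepath x z +++ linepath z y"
  have "dist (?g s) (?g t) \<le> \<phi> t - \<phi> s" if "s \<le> t" for s t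
  proof -
    consider "t \<le> 1/2" | "s \<le> 1/2" "1/2 < t" | "1/2 < s"
      using that by linarith
    then show ?thesis
    proof cases
      case 1
      then show ?thesis
        using that by (simp add: joinpaths_def \<phi>_def dist_linepath algebra_simps)
    next
      case 2
      \<comment> \<open>The two points lie on different segments, so both are compared with the
        corner \<open>z\<close>.\<close>
      have "dist (linepath x z (2 * s)) (linepath z y (2 * t - 1)) \<le>
          dist (linepath x z (2 * s)) (linepath x z 1) + dist (linepath z y 0) (linepath z y (2 * t - 1))"
        by (metis dist_triangle linepath_0' linepath_1')
      also have "\<dots> = (1 - 2 * s) * dist x z + (2 * t - 1) * dist z y"
        unfolding dist_linepath using 2 by simp
      finally show ?thesis
        using 2 by (simp add: joinpaths_def \<phi>_def algebra_simps)
    next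
      case 3
      have "2 * \<bar>t - s\<bar> = 2 * t - 2 * s"
        using that by simp
      then show ?thesis
        using that 3 by (simp add: joinpaths_def \<phi>_def dist_linepath flip: left_diff_distrib)
    qed
  qed
  then show ?thesis
    using path_length_le_of_modulus[of ?g \<phi>] by (simp add: \<phi>_def)
qed

lemma inner_dist_two_segments_le:
  fixes x y z :: "'a::real_normed_vector"
  assumes "closed_segment x z \<subseteq> Y" "closed_segment z y \<subseteq> Y"
  shows "inner_dist Y x y \<le> ereal (dist x z + dist z y)"
proof -
  let ?g = "linepath x z +++ linepath z y"
  have "path_length ?g < \<infinity>"
    by (rule le_less_trans[OF path_length_two_segments_le]) simp
  then have "rectifiable_path ?g"
    by (simp add: rectifiable_path_def)
  moreover have "path_image ?g \<subseteq> Y"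
    using assms by (simp add: path_image_join)
  ultimately have "inner_dist Y x y \<le> path_length ?g"
    unfolding inner_dist_def by (intro INF_lower) auto
  then show ?thesis
    using path_length_two_segments_le order_trans by blast
qed

text \<open>The partition 0, \<open>s\<close>, 1, with the path at \<open>z\<close> at time
  \<open>s\<close>, already gives this length. Serves the lower bound for the optimal
  constant.\<close>

lemma path_length_ge_via:
  assumes "z \<in> path_image g"
  shows "ereal (dist (pathstart g) z + dist z (pathfinish g)) \<le> path_length g"
proof -
  obtain s where s: "0 \<le> s" "s \<le> 1" "z = g s"
    using assms by (auto simp: path_image_def)
  define t :: "nat \<Rightarrow> real" where "t i = (if i = 0 then 0 else if i = 1 then s else 1)" for i
  have "mono t"
    using s by (auto simp: mono_def t_def)
  moreover have "range t \<subseteq> {0..1}"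
    using s by (auto simp: t_def)
  ultimately have "ereal (\<Sum>i<2. dist (g (t i)) (g (t (Suc i)))) \<le> path_length g"
    unfolding path_length_def by (intro SUP_upper2[of "(t, 2)"]) auto
  then show ?thesis
    by (simp add: t_def s pathstart_def pathfinish_def numeral_2_eq_2)
qed

section \<open>Inner distance in finite unions of linear subspaces\<close>

lemma closed_segment_subset_subspace:
  assumes "subspace L" "x \<in> L" "y \<in> L"
  shows "closed_segment x y \<subseteq> L"
  using assms by (simp add: closed_segment_subset subspace_imp_convex)

text \<open>Write \<open>x = p + a\<close> and \<open>y = q + b\<close> with \<open>p, q \<in> L \<inter> M\<close> and \<open>a, b\<close> orthogonal to
  \<open>L \<inter> M\<close>. The path goes straight from \<open>x\<close> to the point \<open>z\<close> dividing the segment from \<open>p\<close> to \<open>q\<close>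
  in the ratio \<open>norm a : norm b\<close> and on to \<open>y\<close>; unfolded into a plane, it becomes a segment of
  length \<open>sqrt ((norm a + norm b)^2 + (dist p q)^2)\<close>.\<close>

lemma inner_dist_between_subspaces_le:
  fixes L M :: "'a::euclidean_space set"
  assumes sub: "subspace L" "subspace M" and Y: "L \<subseteq> Y" "M \<subseteq> Y"
    and xy: "x \<in> L" "y \<in> M" and C: "1 \<le> C"
    and transversal: "\<And>a b. a \<in> L \<inter> (L \<inter> M)\<^sup>\<bottom> \<Longrightarrow> b \<in> M \<inter> (L \<inter> M)\<^sup>\<bottom> \<Longrightarrow>
      norm a + norm b \<le> C * norm (a - b)"
  shows "inner_dist Y x y \<le> ereal (C * dist x y)"
proof -
  let ?N = "(L \<inter> M)\<^sup>\<bottom>"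
  have LM: "subspace (L \<inter> M)"
    using sub by (rule subspace_inter)
  then have span: "span (L \<inter> M) = L \<inter> M"
    by simp
  have decomp: "\<exists>p\<in>L \<inter> M. v - p \<in> ?N" for v
  proof -
    obtain p w where "p \<in> L \<inter> M" "\<And>u. u \<in> L \<inter> M \<Longrightarrow> orthogonal w u" "v = p + w"
      using orthogonal_subspace_decomp_exists[of "L \<inter> M" v] unfolding span by blast
    then show ?thesis
      by (intro bexI[of _ p]) (auto simp: orthogonal_comp_def orthogonal_commute)
  qed
  obtain p where p: "p \<in> L" "p \<in> M" "x - p \<in> ?N"
    using decomp by blast
  obtain q where q: "q \<in> L" "q \<in> M" "y - q \<in> ?N"
    using decomp by blast
  \<comment> \<open>If \<open>s = 0\<close>, then \<open>a\<close> and \<open>b\<close> vanish, and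
    the default 0 for \<open>\<theta>\<close> keeps \<open>norm a = \<theta> * s\<close> and
    \<open>norm b = (1 - \<theta>) * s\<close> true.\<close>
  define a b s \<theta> where "a = x - p" and "b = y - q" and "s = norm a + norm b"
    and "\<theta> = (if s = 0 then 0 else norm a / s)"
  have x: "x = p + a" and y: "y = q + b"
    by (simp_all add: a_def b_def)
  have ab: "a \<in> L" "b \<in> M" "a \<in> ?N" "b \<in> ?N"
    using sub p q xy by (auto simp: a_def b_def subspace_diff)
  have pq_orth: "orthogonal (p - q) (a - b)"
  proof -
    have "a - b \<in> ?N"
      using ab subspace_orthogonal_comp subspace_diff by blast
    moreover have "p - q \<in> L \<inter> M"
      using sub p q by (simp add: subspace_diff)
    ultimately show ?thesis
      by (auto simp: orthogonal_comp_def)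
  qed
  have dist_xy: "(dist x y)\<^sup>2 = (norm (p - q))\<^sup>2 + (norm (a - b))\<^sup>2"
    using norm_add_Pythagorean[OF pq_orth] by (simp add: x y dist_norm algebra_simps)
  define z where "z = p + \<theta> *\<^sub>R (q - p)"
  have s: "0 \<le> s" "norm a = \<theta> * s" "norm b = (1 - \<theta>) * s"
    by (auto simp: s_def \<theta>_def field_simps add_nonneg_eq_0_iff)
  have \<theta>: "0 \<le> \<theta>" "\<theta> \<le> 1"
    using s(1) by (auto simp: \<theta>_def) (simp add: s_def divide_le_eq_1)
  have z: "z \<in> L" "z \<in> M"
    using sub p q by (simp_all add: z_def subspace_add subspace_diff subspace_scale)
  have hyp: "sqrt ((c * s)\<^sup>2 + (c * d)\<^sup>2) = c * sqrt (s\<^sup>2 + d\<^sup>2)" if "0 \<le> c" for c d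
    using that by (simp add: power_mult_distrib real_sqrt_mult flip: distrib_left)
  have leg: "norm (u + c *\<^sub>R (p - q)) = sqrt ((norm u)\<^sup>2 + (c * norm (p - q))\<^sup>2)"
    if "u \<in> ?N" for u c
  proof -
    have "c *\<^sub>R (p - q) \<in> L \<inter> M"
      using sub p q by (simp add: subspace_diff subspace_scale)
    then have "orthogonal u (c *\<^sub>R (p - q))"
      using that by (auto simp: orthogonal_comp_def orthogonal_commute)
    from norm_add_Pythagorean[OF this]
    have "(norm (u + c *\<^sub>R (p - q)))\<^sup>2 = (norm u)\<^sup>2 + (c * norm (p - q))\<^sup>2"
      by (simp add: power_mult_distrib)
    then show ?thesis
      by (metis norm_ge_zero real_sqrt_unique)
  qed
  have "x - z = a + \<theta> *\<^sub>R (p - q)" "y - z = b + (\<theta> - 1) *\<^sub>R (p - q)"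
    by (simp_all add: x y z_def algebra_simps)
  then have "dist x z = sqrt ((\<theta> * s)\<^sup>2 + (\<theta> * norm (p - q))\<^sup>2)"
    and "dist y z = sqrt (((1 - \<theta>) * s)\<^sup>2 + ((1 - \<theta>) * norm (p - q))\<^sup>2)"
    using ab s by (simp_all add: dist_norm leg power_mult_distrib power2_commute)
  \<comment> \<open>Both legs are hypotenuses of right triangles similar to the one with sides
    \<open>s\<close> and \<open>norm (p - q)\<close>, scaled by \<open>\<theta>\<close> and
    \<open>1 - \<theta>\<close>, so their lengths add up to its hypotenuse.\<close>
  then have "dist x z = \<theta> * sqrt (s\<^sup>2 + (norm (p - q))\<^sup>2)"
    and "dist y z = (1 - \<theta>) * sqrt (s\<^sup>2 + (norm (p - q))\<^sup>2)"
    using \<theta> hyp by simp_all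
  then have "dist x z + dist z y = sqrt (s\<^sup>2 + (norm (p - q))\<^sup>2)"
    by (simp add: dist_commute algebra_simps)
  also have "\<dots> \<le> sqrt ((C * dist x y)\<^sup>2)"
  proof (rule real_sqrt_le_mono)
    have "s\<^sup>2 \<le> (C * norm (a - b))\<^sup>2"
      using transversal[of a b] ab s(1) by (intro power_mono) (auto simp: s_def)
    moreover have "(norm (p - q))\<^sup>2 \<le> C\<^sup>2 * (norm (p - q))\<^sup>2"
      using C by (simp add: mult_le_cancel_right1)
    ultimately show "s\<^sup>2 + (norm (p - q))\<^sup>2 \<le> (C * dist x y)\<^sup>2"
      by (simp add: power_mult_distrib dist_xy algebra_simps)
  qed
  also have "\<dots> = C * dist x y"
    using C by simp
  finally have "dist x z + dist z y \<le> C * dist x y" .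
  moreover have "inner_dist Y x y \<le> ereal (dist x z + dist z y)"
    using closed_segment_subset_subspace[of L x z] closed_segment_subset_subspace[of M z y] sub xy z Y
    by (intro inner_dist_two_segments_le) blast+
  ultimately show ?thesis
    using order_trans by fastforce
qed

text \<open>The map taking \<open>(a, b)\<close> to \<open>a - b\<close> is linear and, the
  intersection being trivial, injective on \<open>L \<times> M\<close>; in finite dimension it is
  then bounded below by a positive multiple of the norm.\<close>

lemma transversal_subspaces_constant:
  fixes L M :: "'a::euclidean_space set"
  assumes "subspace L" "subspace M" "L \<inter> M = {0}"
  obtains C where "1 \<le> C" "\<And>a b. a \<in> L \<Longrightarrow> b \<in> M \<Longrightarrow> norm a + norm b \<le> C * norm (a - b)"
proof -
  have "\<exists>e>0. \<forall>w\<in>L \<times> M. e * norm w \<le> norm (fst w - snd w)"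
  proof (rule injective_imp_isometric)
    show "closed (L \<times> M)"
      using assms by (simp add: closed_Times closed_subspace)
    show "subspace (L \<times> M)"
      using assms by (simp add: subspace_Times)
    show "bounded_linear (\<lambda>w::'a \<times> 'a. fst w - snd w)"
      by (intro bounded_linear_sub bounded_linear_fst bounded_linear_snd)
    show "\<forall>w\<in>L \<times> M. fst w - snd w = 0 \<longrightarrow> w = 0"
      using assms(3) by (auto simp: zero_prod_def)
  qed
  then obtain e where e: "e > 0" "\<And>a b. a \<in> L \<Longrightarrow> b \<in> M \<Longrightarrow> e * norm (a, b) \<le> norm (a - b)"
    by (metis fst_conv snd_conv mem_Sigma_iff)
  \<comment> \<open>The 2 counts the two components, each at most \<open>norm (a, b)\<close>; the
    maximum with 1 secures \<open>1 \<le> C\<close>.\<close>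
  show thesis
  proof (rule that[of "max 1 (2 / e)"])
    fix a b
    assume ab: "a \<in> L" "b \<in> M"
    have "norm a + norm b \<le> 2 * norm (a, b)"
      using norm_fst_le[of a b] norm_snd_le[of b a] by linarith
    also have "\<dots> \<le> 2 / e * norm (a - b)"
      using e(2)[OF ab] e(1) by (simp add: field_simps)
    also have "\<dots> \<le> max 1 (2 / e) * norm (a - b)"
      by (intro mult_right_mono) auto
    finally show "norm a + norm b \<le> max 1 (2 / e) * norm (a - b)" .
  qed simp
qed

text \<open>A vector of \<open>L \<inter> M\<close> that is orthogonal to
  \<open>L \<inter> M\<close> is orthogonal to itself, so the normal parts of \<open>L\<close> and
  \<open>M\<close> meet only in 0.\<close>

lemma inner_dist_between_subspaces_bounded:
  fixes L M :: "'a::euclidean_space set"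
  assumes "subspace L" "subspace M" "L \<subseteq> Y" "M \<subseteq> Y"
  shows "\<exists>C. \<forall>x\<in>L. \<forall>y\<in>M. inner_dist Y x y \<le> ereal (C * dist x y)"
proof -
  let ?N = "(L \<inter> M)\<^sup>\<bottom>"
  have sub: "subspace (L \<inter> ?N)" "subspace (M \<inter> ?N)"
    using assms by (simp_all add: subspace_inter subspace_orthogonal_comp)
  have "x = 0" if "x \<in> L \<inter> ?N \<inter> (M \<inter> ?N)" for x
    using that by (simp add: orthogonal_comp_def flip: orthogonal_self)
  then have "L \<inter> ?N \<inter> (M \<inter> ?N) = {0}"
    using subspace_0[OF sub(1)] subspace_0[OF sub(2)] by blast
  then obtain C where "1 \<le> C"
    "\<And>a b. a \<in> L \<inter> ?N \<Longrightarrow> b \<in> M \<inter> ?N \<Longrightarrow> norm a + norm b \<le> C * norm (a - b)"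
    using transversal_subspaces_constant[OF sub] by blast
  then show ?thesis
    using inner_dist_between_subspaces_le[OF assms] by blast
qed

text \<open>There are finitely many pairs of members, so the largest of their constants serves all
  pairs.\<close>

lemma finite_union_subspaces_lipschitz_normally_embedded:
  fixes \<L> :: "'a::euclidean_space set set"
  assumes "finite \<L>" "\<And>L. L \<in> \<L> \<Longrightarrow> subspace L"
  shows "lipschitz_normally_embedded (\<Union>\<L>)"
proof -
  let ?Y = "\<Union>\<L>"
  have "\<exists>C. \<forall>x\<in>L. \<forall>y\<in>M. inner_dist ?Y x y \<le> ereal (C * dist x y)"
    if "L \<in> \<L>" "M \<in> \<L>" for L M
    using that assms by (intro inner_dist_between_subspaces_bounded) auto
  then obtain C where C: "\<And>L M x y. \<lbrakk>L \<in> \<L>; M \<in> \<L>; x \<in> L; y \<in> M\<rbrakk> \<Longrightarrow>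
      inner_dist ?Y x y \<le> ereal (C L M * dist x y)"
    by metis
  \<comment> \<open>The inserted 1 gives \<open>1 \<le> K\<close> and keeps the maximum meaningful
    for an empty family.\<close>
  define K where "K = Max (insert 1 ((\<lambda>(L, M). C L M) ` (\<L> \<times> \<L>)))"
  have fin: "finite (insert 1 ((\<lambda>(L, M). C L M) ` (\<L> \<times> \<L>)))"
    using assms by simp
  have "1 \<le> K"
    unfolding K_def by (rule Max_ge[OF fin]) simp
  moreover have "inner_dist_bound ?Y K"
    unfolding inner_dist_bound_def
  proof (intro ballI)
    fix x y
    assume "x \<in> ?Y" "y \<in> ?Y"
    then obtain L M where LM: "L \<in> \<L>" "M \<in> \<L>" "x \<in> L" "y \<in> M"
      by blast
    then have "C L M \<le> K"
      unfolding K_def by (intro Max_ge[OF fin]) force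
    then have "ereal (C L M * dist x y) \<le> ereal (K * dist x y)"
      by (simp add: mult_right_mono)
    then show "inner_dist ?Y x y \<le> ereal (K * dist x y)"
      using C[OF LM] order_trans by blast
  qed
  ultimately show ?thesis
    unfolding lipschitz_normally_embedded_def by blast
qed

section \<open>Complex subspaces as real ones; subspaces covered by finitely many others\<close>

lemma matrix_subspace_complex:
  fixes L :: "(complex^'n^'m) set"
  assumes "matrix_subspace L"
  shows "subspace L"
proof -
  have "(\<chi> i. complex_of_real c *s A $ i) = c *\<^sub>R A" for c and A :: "complex^'n^'m"
    by (simp add: vec_eq_iff) (simp add: scaleR_conv_of_real)
  then show ?thesis
    using assms unfolding matrix_subspace_iff subspace_def by metis
qed

text \<open>For \<open>u \<in> L - M\<close> and \<open>v \<in> L\<close> outside the other subspaces (so \<open>v \<in> M\<close>), no \<open>u + t *\<^sub>R v\<close> lies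
  in \<open>M\<close>, so two of these infinitely many points share another member, which then contains \<open>v\<close>.\<close>

lemma subspace_in_finite_union:
  fixes L :: "'a::real_vector set"
  assumes "finite \<M>" "subspace L" "\<And>M. M \<in> \<M> \<Longrightarrow> subspace M" "L \<subseteq> \<Union>\<M>"
  shows "\<exists>M\<in>\<M>. L \<subseteq> M"
  using assms(1,3,4)
proof (induction \<M> rule: finite_induct)
  case empty
  then show ?case
    using subspace_0[OF \<open>subspace L\<close>] by auto
next
  case (insert M \<M>)
  show ?case
  proof (rule ccontr)
    assume contra: "\<not> ?case"
    then obtain u where u: "u \<in> L" "u \<notin> M"
      by blast
    have "\<not> L \<subseteq> \<Union>\<M>"
      using insert contra by auto
    then obtain v where v: "v \<in> L" "v \<notin> \<Union>\<M>"
      by blast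
    then have "v \<in> M"
      using insert.prems by blast
    have "subspace M"
      using insert.prems by blast
    have "u + t *\<^sub>R v \<notin> M" for t
      using u subspace_diff[OF \<open>subspace M\<close>, of "u + t *\<^sub>R v" "t *\<^sub>R v"]
        subspace_scale[OF \<open>subspace M\<close> \<open>v \<in> M\<close>] by auto
    moreover have "u + t *\<^sub>R v \<in> L" for t
      using u v \<open>subspace L\<close> by (simp add: subspace_add subspace_scale)
    ultimately have "\<exists>N\<in>\<M>. u + t *\<^sub>R v \<in> N" for t
      using insert.prems by blast
    then obtain N where N: "\<And>t. N t \<in> \<M>" "\<And>t. u + t *\<^sub>R v \<in> N t"
      by metis
    have "\<not> inj_on N UNIV"
      using N(1) insert.hyps(1) infinite_UNIV_char_0[where 'a = real]
      by (metis finite_imageD finite_subset image_subsetI)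
    then obtain s t where "s \<noteq> t" "N s = N t"
      by (auto simp: inj_on_def)
    have N': "subspace (N s)"
      using N(1) insert.prems by blast
    have "(u + s *\<^sub>R v) - (u + t *\<^sub>R v) \<in> N s"
      using N(2) \<open>N s = N t\<close> by (metis N' subspace_diff)
    then have "(s - t) *\<^sub>R v \<in> N s"
      by (simp add: algebra_simps)
    then have "v \<in> N s"
      using \<open>s \<noteq> t\<close> subspace_scale[OF N', of "(s - t) *\<^sub>R v" "inverse (s - t)"] by simp
    then show False
      using v N(1) by blast
  qed
qed

section \<open>Triangular matrices and the hyperplanes of a vanishing diagonal entry\<close>

text \<open>Upper and lower triangular matrices are the cases \<open>(<)\<close> and \<open>(>)\<close> of the order \<open>lt\<close>.\<close>

locale triangular =
  fixes lt :: "'k::finite \<Rightarrow> 'k \<Rightarrow> bool"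
  assumes lt_irrefl: "\<not> lt i i"
    and lt_trans: "lt i j \<Longrightarrow> lt j l \<Longrightarrow> lt i l"
    and lt_total: "i \<noteq> j \<Longrightarrow> lt i j \<or> lt j i"
begin

definition mats :: "(real^'k^'k) set" where
  "mats = {A. \<forall>i j. lt j i \<longrightarrow> A $ i $ j = 0}"

definition zero_diag :: "'k \<Rightarrow> (real^'k^'k) set" where
  "zero_diag i = {A \<in> mats. A $ i $ i = 0}"

text \<open>The unit normal vector of the hyperplane \<open>zero_diag i\<close> inside
  \<open>mats\<close>.\<close>

definition diag_unit :: "'k \<Rightarrow> real^'k^'k" where
  "diag_unit i = axis i (axis i 1)"

lemma diag_unit_nth: "diag_unit i $ a $ b = (if a = i \<and> b = i then 1 else 0)"
  by (auto simp: diag_unit_def axis_def)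

lemma subspace_zero_diag: "subspace (zero_diag i)"
  by (auto simp: subspace_def zero_diag_def mats_def)

lemma diag_unit_mats: "diag_unit i \<in> mats"
  by (auto simp: mats_def diag_unit_nth lt_irrefl)

text \<open>\<open>diag_unit j\<close> lies in every hyperplane but the \<open>j\<close>-th and so
  separates them.\<close>

lemma zero_diag_subset_iff: "zero_diag i \<subseteq> zero_diag j \<longleftrightarrow> i = j"
proof
  assume sub: "zero_diag i \<subseteq> zero_diag j"
  show "i = j"
  proof (rule ccontr)
    assume "i \<noteq> j"
    then have "diag_unit j \<in> zero_diag i"
      by (auto simp: zero_diag_def diag_unit_mats diag_unit_nth)
    then have "diag_unit j \<in> zero_diag j"
      using sub by blast
    then show False
      by (simp add: zero_diag_def diag_unit_nth)
  qed
qed simp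

section \<open>Ranks of triangular matrices and the closure of the corank-one stratum\<close>

lemma rank_full:
  assumes A: "A \<in> mats" and diag: "\<And>i. A $ i $ i \<noteq> 0"
  shows "rank A = CARD('k)"
  unfolding full_rank_injective
proof (rule iffD2[OF linear_injective_0[OF matrix_vector_mul_linear]], intro allI impI)
  fix x
  assume Ax: "A *v x = 0"
  show "x = 0"
  proof (rule ccontr)
    assume "x \<noteq> 0"
    then have "{i. x $ i \<noteq> 0} \<noteq> {}"
      by (auto simp: vec_eq_iff)
    \<comment> \<open>Back substitution: \<open>m\<close> is a \<open>lt\<close>-maximal index in
      the support of \<open>x\<close>. In row \<open>m\<close> the entries before the diagonal
      vanish, and so do the coordinates of \<open>x\<close> after \<open>m\<close>; only the
      diagonal term is left.\<close>
    then have "\<exists>m\<in>{i. x $ i \<noteq> 0}. \<forall>i\<in>{i. x $ i \<noteq> 0}. i \<noteq> m \<longrightarrow> \<not> lt m i"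
      by (intro Finite_Set.bex_max_element)
        (auto intro!: asymp_onI transp_onI dest: lt_trans simp: lt_irrefl)
    then obtain m where m: "x $ m \<noteq> 0" "\<And>i. x $ i \<noteq> 0 \<Longrightarrow> i \<noteq> m \<Longrightarrow> \<not> lt m i"
      by auto
    have "A $ m $ j * x $ j = 0" if "j \<noteq> m" for j
      using lt_total[OF that] A m(2)[of j] that by (auto simp: mats_def)
    then have "(\<Sum>j\<in>UNIV - {m}. A $ m $ j * x $ j) = 0"
      by (intro sum.neutral) blast
    then have "(A *v x) $ m = A $ m $ m * x $ m"
      by (simp add: matrix_vector_mult_def sum.remove[of UNIV m])
    then show False
      using Ax m(1) diag by simp
  qed
qed

text \<open>If \<open>A $ i $ i = 0\<close>, then \<open>A\<close> maps the coordinate subspace of indices up to \<open>i\<close> into the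
  coordinate subspace of indices below \<open>i\<close>.\<close>

lemma rank_not_full:
  assumes A: "A \<in> zero_diag i"
  shows "rank A < CARD('k)"
proof -
  define S S' :: "(real^'k) set"
    where "S = {x. \<forall>j. lt i j \<longrightarrow> x $ j = 0}" and "S' = {x \<in> S. x $ i = 0}"
  have sub: "subspace S" "subspace S'"
    by (auto simp: S_def S'_def subspace_def)
  have image: "(*v) A ` S \<subseteq> S'"
  proof clarify
    fix x
    assume x: "x \<in> S"
    have "A $ j $ l * x $ l = 0" if "j = i \<or> lt i j" for j l
    proof (cases "lt i l")
      case True
      then show ?thesis
        using x by (simp add: S_def)
    next
      case False
      then have "lt l j \<or> l = i \<and> j = i"
        using that lt_total[of i l] lt_trans by blast
      then show ?thesis
        using A by (auto simp: zero_diag_def mats_def)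
    qed
    then have "(A *v x) $ j = 0" if "j = i \<or> lt i j" for j
      using that by (auto simp: matrix_vector_mult_def intro!: sum.neutral)
    then show "A *v x \<in> S'"
      by (auto simp: S_def S'_def)
  qed
  have "axis i 1 \<in> S - S'"
    by (auto simp: S_def S'_def axis_def lt_irrefl)
  moreover have "S' \<subseteq> S"
    by (auto simp: S'_def)
  ultimately have "dim S' < dim S"
    using subspace_dim_equal[OF sub(2,1)] by (metis Diff_iff leI)
  \<comment> \<open>An injective map would keep the dimension of \<open>S\<close>, for which
    \<open>S'\<close> has no room.\<close>
  have "\<not> inj ((*v) A)"
  proof
    assume "inj ((*v) A)"
    then have "dim ((*v) A ` S) = dim S"
      by (intro dim_image_eq) (auto intro: inj_on_subset)
    then show False
      using dim_subset[OF image] \<open>dim S' < dim S\<close> by simp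
  qed
  then show ?thesis
    using rank_bound[of A] full_rank_injective[of A] by simp
qed

text \<open>Filling the single gap in the diagonal by \<open>diag_unit i\<close> yields full rank
  and alters only column \<open>i\<close>, by a coordinate vector; this raises the rank by at most
  one.\<close>

lemma rank_corank_one:
  assumes A: "A \<in> zero_diag i" and diag: "\<And>j. j \<noteq> i \<Longrightarrow> A $ j $ j \<noteq> 0"
  shows "rank A = CARD('k) - 1"
proof -
  let ?B = "A + diag_unit i"
  have "?B \<in> mats"
    using A diag_unit_mats[of i] by (simp add: zero_diag_def mats_def)
  moreover have "?B $ j $ j \<noteq> 0" for j
    using A diag[of j] by (auto simp: zero_diag_def diag_unit_nth)
  ultimately have "CARD('k) = dim (columns ?B)"
    using rank_full[of ?B] by (simp add: column_rank_def)
  also have "\<dots> \<le> dim (insert (axis i 1) (columns A))"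
  proof -
    have "column j ?B \<in> span (insert (axis i 1) (columns A))" for j
    proof -
      have "column j ?B = column j A + (if j = i then 1 else 0) *\<^sub>R axis i 1"
        by (auto simp: column_def diag_unit_def axis_def vec_eq_iff)
      moreover have "column j A \<in> span (insert (axis i 1) (columns A))"
        by (intro span_base) (auto simp: columns_def)
      moreover have "axis i 1 \<in> span (insert (axis i 1) (columns A))"
        by (intro span_base) simp
      ultimately show ?thesis
        by (metis span_add span_scale)
    qed
    then have "columns ?B \<subseteq> span (insert (axis i 1) (columns A))"
      by (auto simp: columns_def)
    then show ?thesis
      by (metis dim_subset dim_span)
  qed
  also have "\<dots> \<le> rank A + 1"
    by (simp add: dim_insert column_rank_def)
  finally show ?thesis
    using rank_not_full[OF A] by linarith
qed

text \<open>A diagonal without zeros forces full rank, so the stratum lies in the closed union;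
  conversely, a matrix with zeros on the diagonal is a limit of matrices with exactly one.\<close>

lemma closure_corank_one: "closure (rank_stratum mats (CARD('k) - 1)) = (\<Union>i. zero_diag i)"
proof
  have "rank_stratum mats (CARD('k) - 1) \<subseteq> (\<Union>i. zero_diag i)"
  proof
    fix A
    assume A: "A \<in> rank_stratum mats (CARD('k) - 1)"
    have "CARD('k) - 1 \<noteq> CARD('k)"
      using zero_less_card_finite[where 'a = 'k] by linarith
    then obtain i where "A $ i $ i = 0"
      using A rank_full[of A] by (auto simp: rank_stratum_def)
    then show "A \<in> (\<Union>i. zero_diag i)"
      using A by (auto simp: rank_stratum_def zero_diag_def)
  qed
  moreover have "closed (\<Union>i. zero_diag i)"
    by (intro closed_UN) (auto simp: closed_subspace subspace_zero_diag)
  ultimately show "closure (rank_stratum mats (CARD('k) - 1)) \<subseteq> (\<Union>i. zero_diag i)"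
    by (rule closure_minimal)
next
  show "(\<Union>i. zero_diag i) \<subseteq> closure (rank_stratum mats (CARD('k) - 1))"
  proof clarify
    fix i A
    assume A: "A \<in> zero_diag i"
    \<comment> \<open>\<open>D\<close> marks the zero diagonal entries other than the
      \<open>i\<close>-th; adding a positive multiple of it makes exactly these nonzero.\<close>
    define D :: "real^'k^'k"
      where "D = (\<chi> a b. if a = b \<and> a \<noteq> i \<and> A $ a $ a = 0 then 1 else 0)"
    define B where "B n = A + inverse (real (Suc n)) *\<^sub>R D" for n
    have "B n \<in> zero_diag i" for n
      using A by (auto simp: B_def D_def zero_diag_def mats_def lt_irrefl)
    moreover have "B n $ j $ j \<noteq> 0" if "j \<noteq> i" for n j
      using that by (auto simp: B_def D_def)
    ultimately have "B n \<in> rank_stratum mats (CARD('k) - 1)" for n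
      using rank_corank_one[of "B n" i] by (simp add: rank_stratum_def zero_diag_def)
    moreover have "B \<longlonglongrightarrow> A + 0 *\<^sub>R D"
      unfolding B_def by (intro tendsto_intros LIMSEQ_inverse_real_of_nat)
    ultimately show "A \<in> closure (rank_stratum mats (CARD('k) - 1))"
      unfolding closure_sequential by auto
  qed
qed

section \<open>Right angles between the hyperplanes and the optimal constant\<close>

lemma normal_part_eq:
  assumes u: "u \<in> zero_diag i" "u \<in> (zero_diag i \<inter> zero_diag j)\<^sup>\<bottom>" and "i \<noteq> j"
  shows "u = (u $ j $ j) *\<^sub>R diag_unit j"
proof -
  \<comment> \<open>\<open>w\<close> lies in both hyperplanes, hence is orthogonal to
    \<open>u\<close> and to \<open>diag_unit j\<close>, and so to itself.\<close>
  define w where "w = u - (u $ j $ j) *\<^sub>R diag_unit j"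
  have w: "w \<in> zero_diag i \<inter> zero_diag j"
    using u(1) \<open>i \<noteq> j\<close> by (auto simp: w_def zero_diag_def mats_def diag_unit_nth lt_irrefl)
  have "inner w (diag_unit j) = 0"
    using w by (simp add: diag_unit_def inner_axis zero_diag_def)
  moreover have "inner w u = 0"
    using u(2) w by (auto simp: orthogonal_comp_def orthogonal_def)
  moreover have "inner w w = inner w u - u $ j $ j * inner w (diag_unit j)"
    by (subst (2) w_def) (simp add: inner_diff_right)
  ultimately have "inner w w = 0"
    by simp
  then show ?thesis
    by (simp add: w_def)
qed

text \<open>\<open>u\<close> is a multiple of \<open>diag_unit j\<close>, and pairing the latter
  with \<open>v\<close> reads off the \<open>(j, j)\<close> entry of \<open>v\<close>, which is
  0.\<close>

lemma normal_parts_orthogonal: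
  assumes "i \<noteq> j" "u \<in> zero_diag i \<inter> (zero_diag i \<inter> zero_diag j)\<^sup>\<bottom>"
    and v: "v \<in> zero_diag j \<inter> (zero_diag i \<inter> zero_diag j)\<^sup>\<bottom>"
  shows "inner u v = 0"
proof -
  have "u = (u $ j $ j) *\<^sub>R diag_unit j"
    using assms by (intro normal_part_eq) auto
  then have "inner u v = u $ j $ j * inner (diag_unit j) v"
    by (metis inner_scaleR_left)
  also have "\<dots> = 0"
    using v by (simp add: diag_unit_def inner_axis' zero_diag_def)
  finally show ?thesis .
qed

lemma orthogonal_zero_diag:
  assumes "i \<noteq> j"
  shows "orthogonal_subspaces (zero_diag i) (zero_diag j)"
proof -
  let ?N = "(zero_diag i \<inter> zero_diag j)\<^sup>\<bottom>"
  let ?P = "(zero_diag i \<inter> ?N - {0}) \<times> (zero_diag j \<inter> ?N - {0})"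
  \<comment> \<open>The unit normals witness that the infimum is over a nonempty set; on it the
    angle is constant.\<close>
  have "diag_unit j \<in> zero_diag i \<inter> ?N - {0}" "diag_unit i \<in> zero_diag j \<inter> ?N - {0}"
    using assms
    by (auto simp: zero_diag_def diag_unit_mats diag_unit_nth orthogonal_comp_def orthogonal_def)
      (auto simp: diag_unit_def inner_axis)
  then have "?P \<noteq> {}"
    by blast
  then have "(\<lambda>_. pi / 2) ` ?P = {pi / 2}"
    by (rule image_constant_conv[THEN trans, OF if_not_P])
  moreover have "(\<lambda>(u, v). arccos (inner u v / (norm u * norm v))) ` ?P = (\<lambda>_. pi / 2) ` ?P"
    by (intro image_cong refl) (auto simp: normal_parts_orthogonal[OF assms] arccos_0)
  ultimately have "subspace_angle (zero_diag i) (zero_diag j) = pi / 2"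
    unfolding subspace_angle_def by (metis cInf_singleton)
  then show ?thesis
    using assms by (auto simp: orthogonal_subspaces_def zero_diag_subset_iff)
qed

lemma inner_dist_bound_sqrt2: "inner_dist_bound (\<Union>i. zero_diag i) (sqrt 2)"
  unfolding inner_dist_bound_def
proof (intro ballI)
  let ?Y = "\<Union>i. zero_diag i"
  fix x y
  assume "x \<in> ?Y" "y \<in> ?Y"
  then obtain i j where xy: "x \<in> zero_diag i" "y \<in> zero_diag j"
    by blast
  show "inner_dist ?Y x y \<le> ereal (sqrt 2 * dist x y)"
  proof (rule inner_dist_between_subspaces_le[OF subspace_zero_diag subspace_zero_diag _ _ xy])
    fix a b
    assume a: "a \<in> zero_diag i \<inter> (zero_diag i \<inter> zero_diag j)\<^sup>\<bottom>"
      and b: "b \<in> zero_diag j \<inter> (zero_diag i \<inter> zero_diag j)\<^sup>\<bottom>"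
    have "inner a b = 0"
    proof (cases "i = j")
      \<comment> \<open>Here \<open>a\<close> is orthogonal to all of \<open>zero_diag i\<close>,
        which contains \<open>b\<close>.\<close>
      case True
      then show ?thesis
        using a b by (simp add: orthogonal_comp_def orthogonal_def)
    next
      case False
      then show ?thesis
        using normal_parts_orthogonal a b by blast
    qed
    then have "(norm (a - b))\<^sup>2 = (norm a)\<^sup>2 + (norm b)\<^sup>2"
      by (simp add: power2_norm_eq_inner inner_diff inner_commute)
    \<comment> \<open>The constant comes from
      \<open>2 * norm a * norm b \<le> (norm a)^2 + (norm b)^2\<close>.\<close>
    then have "(norm a + norm b)\<^sup>2 \<le> (sqrt 2 * norm (a - b))\<^sup>2"
      using zero_le_power2[of "norm a - norm b"]
      by (simp add: power_mult_distrib power2_sum power2_diff)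
    then show "norm a + norm b \<le> sqrt 2 * norm (a - b)"
      by (rule power2_le_imp_le) simp
  qed auto
qed

text \<open>Take \<open>A\<close> and \<open>B\<close> to be the identity with the \<open>i\<close>-th, resp. \<open>j\<close>-th, diagonal entry replaced
  by 0. By connectedness, a path from \<open>A\<close> to \<open>B\<close> meets a matrix with two zero diagonal entries,
  and such a matrix has distance at least 1 to both ends, which are \<open>sqrt 2\<close> apart.\<close>

lemma sqrt2_le_inner_dist_bound:
  assumes card: "2 \<le> CARD('k)" and K: "inner_dist_bound (\<Union>i. zero_diag i) K"
  shows "sqrt 2 \<le> K"
proof -
  let ?Y = "\<Union>i. zero_diag i"
  obtain i j :: 'k where ij: "i \<noteq> j"
    using card by (metis card_2_iff' ex_card UNIV_I)
  define A B :: "real^'k^'k" where "A = mat 1 - diag_unit i" and "B = mat 1 - diag_unit j"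
  have A: "A \<in> zero_diag i" and B: "B \<in> zero_diag j"
    by (auto simp: A_def B_def zero_diag_def mats_def mat_def diag_unit_nth lt_irrefl)
  have entry: "\<bar>U $ l $ l - V $ l $ l\<bar> \<le> dist U V" for U V :: "real^'k^'k" and l
    by (metis dist_real_def dist_vec_nth_le order_trans)
  have "ereal 2 \<le> path_length g"
    if "rectifiable_path g" "path_image g \<subseteq> ?Y" "pathstart g = A" "pathfinish g = B" for g
  proof -
    \<comment> \<open>\<open>?Z\<close> collects the other hyperplanes. The path starts in
      \<open>zero_diag i\<close> and ends in \<open>?Z\<close>; both are closed, so it meets their
      intersection.\<close>
    let ?Z = "\<Union>l\<in>-{i}. zero_diag l"
    have "connected (path_image g)"
      using that by (simp add: connected_path_image rectifiable_path_def)
    moreover have "closed (zero_diag i)" "closed ?Z"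
      by (auto intro!: closed_UN simp: closed_subspace subspace_zero_diag)
    moreover have "path_image g \<subseteq> zero_diag i \<union> ?Z"
      using that(2) by blast
    moreover have "A \<in> zero_diag i \<inter> path_image g"
      using A that(3) pathstart_in_path_image by blast
    moreover have "B \<in> ?Z \<inter> path_image g"
      using B ij that(4) pathfinish_in_path_image by blast
    ultimately have "zero_diag i \<inter> ?Z \<inter> path_image g \<noteq> {}"
      using connected_closedD[of "path_image g" "zero_diag i" ?Z] by blast
    then obtain z l where z: "z \<in> zero_diag i" "z \<in> zero_diag l" "l \<noteq> i" "z \<in> path_image g"
      by blast
    \<comment> \<open>\<open>z\<close> vanishes at the \<open>l\<close>-th and the
      \<open>i\<close>-th diagonal place, where \<open>A\<close> and \<open>B\<close> respectively
      have a 1.\<close>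
    have "1 \<le> dist A z"
      using entry[where U = A and V = z and l = l] z by (simp add: A_def zero_diag_def mat_def diag_unit_nth)
    moreover have "1 \<le> dist z B"
      using entry[where U = z and V = B and l = i] z ij by (simp add: B_def zero_diag_def mat_def diag_unit_nth)
    ultimately have "ereal 2 \<le> ereal (dist A z + dist z B)"
      by simp
    then show ?thesis
      using path_length_ge_via[OF z(4)] that order_trans by metis
  qed
  then have "ereal 2 \<le> inner_dist ?Y A B"
    unfolding inner_dist_def by (intro INF_greatest) auto
  also have "\<dots> \<le> ereal (K * dist A B)"
    using K A B unfolding inner_dist_bound_def by blast
  also have "dist A B = sqrt 2"
  proof -
    have "A - B = diag_unit j - diag_unit i"
      by (simp add: A_def B_def)
    then have "(dist A B)\<^sup>2 = 2"
      using ij by (simp add: dist_norm power2_norm_eq_inner inner_diff diag_unit_def inner_axis_axis)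
    then show ?thesis
      by (simp add: real_sqrt_unique)
  qed
  finally have "sqrt 2 * sqrt 2 \<le> K * sqrt 2"
    by simp
  then show ?thesis
    by (simp only: mult_le_cancel_right_pos real_sqrt_gt_0_iff zero_less_numeral)
qed

section \<open>The irredundant decomposition into hyperplanes\<close>

lemma union_of_subspaces_zero_diag:
  "union_of_subspaces (range zero_diag) (\<Union>i. zero_diag i)"
  by (auto simp: union_of_subspaces_def matrix_subspace_real subspace_zero_diag)

lemma irredundant_zero_diag: "irredundant (range zero_diag)"
  by (auto simp: irredundant_def zero_diag_subset_iff)

text \<open>\<open>L\<close> lies in some \<open>zero_diag i\<close>, which lies in some member
  \<open>M\<close>; irredundance squeezes the three together. Orthogonality thereby extends to every
  irredundant decomposition.\<close>

lemma irredundant_union_members: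
  assumes un: "union_of_subspaces \<L> (\<Union>i. zero_diag i)" and irr: "irredundant \<L>" and L: "L \<in> \<L>"
  shows "L \<in> range zero_diag"
proof -
  have fin: "finite \<L>" and sub: "\<And>M. M \<in> \<L> \<Longrightarrow> subspace M" and eq: "(\<Union>i. zero_diag i) = \<Union>\<L>"
    using un by (auto simp: union_of_subspaces_def matrix_subspace_real)
  have "\<exists>M\<in>range zero_diag. L \<subseteq> M"
    using L sub eq by (intro subspace_in_finite_union) (auto simp: subspace_zero_diag)
  then obtain i where i: "L \<subseteq> zero_diag i"
    by blast
  have "\<exists>M\<in>\<L>. zero_diag i \<subseteq> M"
    using fin sub eq by (intro subspace_in_finite_union) (auto simp: subspace_zero_diag)
  then have "L = zero_diag i"
    using i irr L unfolding irredundant_def by (metis order_trans subset_antisym)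
  then show ?thesis
    by blast
qed

end

section \<open>The two triangular cases and the conclusion\<close>

lemma triangular_less: "triangular ((<) :: 'k::{finite,linorder} \<Rightarrow> 'k \<Rightarrow> bool)"
  by unfold_locales auto

lemma triangular_greater: "triangular ((>) :: 'k::{finite,linorder} \<Rightarrow> 'k \<Rightarrow> bool)"
  by unfold_locales auto

text \<open>For 1 by 1 matrices \<open>Y\<close> is the zero space and every \<open>K\<close> is a
  bound, hence the condition \<open>2 \<le> CARD('k)\<close> for optimality. Irredundance excludes
  nested subspaces, which are never orthogonal in the present sense.\<close>

theorem mainTheorem4:
  fixes XR :: "(real^'n^'m) set" and XC :: "(complex^'n^'m) set" and r :: nat
    and T :: "(real^'k::{finite,linorder}^'k::{finite,linorder}) set"
  assumes "CARD('m) \<le> CARD('n)"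
    and "T = upper_triangular_matrices \<or> T = lower_triangular_matrices"
  shows "((\<exists>\<L>. union_of_subspaces \<L> (closure (rank_stratum XR r)))
            \<longrightarrow> lipschitz_normally_embedded (closure (rank_stratum XR r)))
       \<and> ((\<exists>\<L>. union_of_subspaces \<L> (closure (rank_stratum XC r)))
            \<longrightarrow> lipschitz_normally_embedded (closure (rank_stratum XC r)))
       \<and> (let Y = closure (rank_stratum T (CARD('k) - 1)) in
            lipschitz_normally_embedded Y
          \<and> (\<exists>\<L>. union_of_subspaces \<L> Y \<and> irredundant \<L>)
          \<and> (\<forall>\<L>. union_of_subspaces \<L> Y \<and> irredundant \<L> \<longrightarrow>
               (\<forall>L\<in>\<L>. \<forall>M\<in>\<L>. L \<noteq> M \<longrightarrow> orthogonal_subspaces L M))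
          \<and> (2 \<le> CARD('k) \<longrightarrow>
               inner_dist_bound Y (sqrt 2) \<and> (\<forall>K. inner_dist_bound Y K \<longrightarrow> sqrt 2 \<le> K)))"
proof -
  \<comment> \<open>The matrix sizes stay generic: the fact serves both \<open>XR\<close> and the
    square triangular matrices.\<close>
  have real: "lipschitz_normally_embedded Y" if "union_of_subspaces \<L> Y"
    for \<L> and Y :: "(real^'a^'b) set"
    using that finite_union_subspaces_lipschitz_normally_embedded
    by (auto simp: union_of_subspaces_def matrix_subspace_real)
  have complex: "lipschitz_normally_embedded Y" if "union_of_subspaces \<L> Y"
    for \<L> and Y :: "(complex^'n^'m) set"
    using that finite_union_subspaces_lipschitz_normally_embedded matrix_subspace_complex
    by (auto simp: union_of_subspaces_def)
  obtain lt :: "'k \<Rightarrow> 'k \<Rightarrow> bool" where "triangular lt" and T: "T = triangular.mats lt"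
  proof -
    have "upper_triangular_matrices = triangular.mats ((<) :: 'k \<Rightarrow> 'k \<Rightarrow> bool)"
      by (simp add: triangular.mats_def[OF triangular_less] upper_triangular_matrices_def)
    moreover have "lower_triangular_matrices = triangular.mats ((>) :: 'k \<Rightarrow> 'k \<Rightarrow> bool)"
      by (simp add: triangular.mats_def[OF triangular_greater] lower_triangular_matrices_def)
    ultimately show thesis
      using that assms(2) triangular_less triangular_greater by metis
  qed
  then interpret triangular lt
    by simp
  let ?Y = "\<Union>i. zero_diag i"
  have orthogonal: "orthogonal_subspaces L M"
    if "union_of_subspaces \<L> ?Y \<and> irredundant \<L>" "L \<in> \<L>" "M \<in> \<L>" "L \<noteq> M" for \<L> L M
  proof -
    have "L \<in> range zero_diag" "M \<in> range zero_diag"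
      using that irredundant_union_members by blast+
    then show ?thesis
      using \<open>L \<noteq> M\<close> by (auto intro: orthogonal_zero_diag)
  qed
  show ?thesis
    unfolding Let_def T closure_corank_one
  proof (intro conjI allI impI ballI)
    show "lipschitz_normally_embedded (closure (rank_stratum XR r))"
      if "\<exists>\<L>. union_of_subspaces \<L> (closure (rank_stratum XR r))"
      using that real by blast
    show "lipschitz_normally_embedded (closure (rank_stratum XC r))"
      if "\<exists>\<L>. union_of_subspaces \<L> (closure (rank_stratum XC r))"
      using that complex by blast
    show "lipschitz_normally_embedded ?Y"
      using union_of_subspaces_zero_diag by (rule real)
    show "\<exists>\<L>. union_of_subspaces \<L> ?Y \<and> irredundant \<L>"
      using union_of_subspaces_zero_diag irredundant_zero_diag by blast
  qed (use orthogonal inner_dist_bound_sqrt2 sqrt2_le_inner_dist_bound in simp_all)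
qed

end
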